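(* Let $\Gamma$ be a $1$-walk-regular graph containing a regular clique. Then $\Gamma$ is a strongly regular graph.
   Context: A graph is $t$-walk-regular if, for every $\ell\ge 0$, the number of walks of length $\ell$ between two vertices $x,y$ depends only on the distance between $x$ and $y$, provided this distance is at most $t$. (In particular a $1$-walk-regular graph is regular.) A clique $C$ in a regular graph is a regular clique if every vertex outside $C$ is adjacent to the same positive number of vertices of $C$. *)

theory Defs
  imports "Graph_Theory.Graph_Theory"
begin

text \<open>
  A finite simple undirected graph is modelled by the locale \<^locale>\<open>graph\<close>: a finite, loop-free
  and symmetric digraph without parallel arcs. An edge \<open>xy\<close> is thus a pair of opposite arcs, and
  walks of length \<open>l\<close> in the undirected sense correspond bijectively to arc walks of length \<open>l\<close>.
\<close>

definition num_walks :: "('a, 'b) pre_digraph \<Rightarrow> nat \<Rightarrow> 'a \<Rightarrow> 'a \<Rightarrow> nat" where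
  "num_walks G l x y = card {p. pre_digraph.awalk G x p y \<and> length p = l}"

text \<open>The distance is the shortest-path length for unit arc weights; it is \<open>\<infinity>\<close> between
  vertices in different components.\<close>

definition graph_dist :: "('a, 'b) pre_digraph \<Rightarrow> 'a \<Rightarrow> 'a \<Rightarrow> ereal" where
  "graph_dist G x y = wf_digraph.\<mu> G (\<lambda>_. 1) x y"

definition walk_regular :: "nat \<Rightarrow> ('a, 'b) pre_digraph \<Rightarrow> bool" where
  "walk_regular t G \<longleftrightarrow>
     (\<forall>l. \<forall>x\<in>verts G. \<forall>y\<in>verts G. \<forall>u\<in>verts G. \<forall>v\<in>verts G.
        graph_dist G x y \<le> ereal (real t) \<longrightarrow> graph_dist G u v = graph_dist G x y \<longrightarrow>
        num_walks G l u v = num_walks G l x y)"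

definition clique :: "('a, 'b) pre_digraph \<Rightarrow> 'a set \<Rightarrow> bool" where
  "clique G C \<longleftrightarrow> C \<subseteq> verts G \<and> (\<forall>x\<in>C. \<forall>y\<in>C. x \<noteq> y \<longrightarrow> x \<rightarrow>\<^bsub>G\<^esub> y)"

text \<open>Used for regular graphs only; 1-walk-regular graphs are regular, since the walks of
  length 2 from a vertex to itself are counted by its degree.\<close>

definition regular_clique :: "('a, 'b) pre_digraph \<Rightarrow> 'a set \<Rightarrow> bool" where
  "regular_clique G C \<longleftrightarrow>
     clique G C \<and> (\<exists>e>0. \<forall>x \<in> verts G - C. card {y \<in> C. x \<rightarrow>\<^bsub>G\<^esub> y} = e)"

text \<open>
  Parameters \<open>(n, k, \<lambda>, \<mu>)\<close>. Complete graphs are admitted as (degenerate) strongly regular graphs;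
  they are 1-walk-regular and contain regular cliques.
\<close>

definition strongly_regular :: "('a, 'b) pre_digraph \<Rightarrow> nat \<Rightarrow> nat \<Rightarrow> nat \<Rightarrow> nat \<Rightarrow> bool" where
  "strongly_regular G n k lam mu \<longleftrightarrow>
     card (verts G) = n \<and>
     (\<forall>x\<in>verts G. out_degree G x = k) \<and>
     (\<forall>x\<in>verts G. \<forall>y\<in>verts G. x \<rightarrow>\<^bsub>G\<^esub> y \<longrightarrow>
        card {z \<in> verts G. x \<rightarrow>\<^bsub>G\<^esub> z \<and> y \<rightarrow>\<^bsub>G\<^esub> z} = lam) \<and>
     (\<forall>x\<in>verts G. \<forall>y\<in>verts G. x \<noteq> y \<longrightarrow> \<not> x \<rightarrow>\<^bsub>G\<^esub> y \<longrightarrow>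
        card {z \<in> verts G. x \<rightarrow>\<^bsub>G\<^esub> z \<and> y \<rightarrow>\<^bsub>G\<^esub> z} = mu)"

end

theory Submission
  imports Defs "HOL-Computational_Algebra.Polynomial"
begin

text \<open>
  Let \<open>A\<close> be the adjacency matrix, \<open>k\<close> the degree, \<open>c\<close> the size of the clique \<open>C\<close>, \<open>e\<close> the number
  of neighbours in \<open>C\<close> of an outside vertex, and \<open>\<tau> = c - 1 - e\<close>. Since \<open>A \<chi> = \<tau> \<chi> + e 1\<close> for the
  characteristic vector \<open>\<chi>\<close> of \<open>C\<close>, the polynomial \<open>(X - k) (X - \<tau>)\<close> annihilates \<open>\<chi>\<close>. Walk-regularity
  makes every \<open>p(A)\<close> constant on the diagonal and on the edges, and expresses \<open>\<chi>\<^sup>T p(A) \<chi>\<close> as a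
  multiple of the diagonal entry of \<open>(k + (c - 1) A) p(A)\<close>. Hence with
  \<open>Q = (X - k) (X - \<tau>) (k + (c - 1) X)\<close> all matrices \<open>r(A) Q(A)\<close> have zero diagonal; in particular
  \<open>Q(A)\<^sup>2\<close> does, and \<open>Q(A) = 0\<close> because it is symmetric. Thus the rows of
  \<open>(A - \<tau>) (k + (c - 1) A)\<close> are eigenvectors for \<open>k\<close>, and constant since \<open>C\<close> makes the graph connected.
  If \<open>c \<ge> 2\<close>, reading off the entries at non-adjacent vertices shows that \<open>A\<^sup>2\<close> is constant there.
  If \<open>c = 1\<close>, the graph is complete.
\<close>

text \<open>Turns pairwise equality into one parameter; if \<open>P\<close> never holds, any
  \<open>c\<close> serves, as in a graph without edges.\<close>

lemma ex_common_value:
  assumes "\<And>x y u w. P x y \<Longrightarrow> P u w \<Longrightarrow> f x y = f u w"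
  shows "\<exists>c. \<forall>x y. P x y \<longrightarrow> f x y = c"
  using assms by metis

section \<open>Walk counts as powers of the adjacency matrix\<close>

context graph
begin

definition adj :: "'a \<Rightarrow> 'a \<Rightarrow> real" where
  "adj x y = of_bool (x \<rightarrow>\<^bsub>G\<^esub> y)"

definition walks :: "nat \<Rightarrow> 'a \<Rightarrow> 'a \<Rightarrow> real" where
  "walks l x y = real (num_walks G l x y)"

text \<open>The entries of the matrix \<open>p(A)\<close>, where \<open>A\<close> is the adjacency matrix.\<close>

definition adj_poly :: "real poly \<Rightarrow> 'a \<Rightarrow> 'a \<Rightarrow> real" where
  "adj_poly p x y = (\<Sum>i\<le>degree p. coeff p i * walks i x y)"

lemma adj_sym: "adj x y = adj y x"
  using sym_arcs by (auto simp: adj_def symmetric_def dest: symD)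

lemma sum_adj: "(\<Sum>z\<in>verts G. adj x z * f z) = (\<Sum>z | x \<rightarrow>\<^bsub>G\<^esub> z. f z)"
proof -
  have "(\<Sum>z\<in>verts G. adj x z * f z) = (\<Sum>z\<in>{z\<in>verts G. x \<rightarrow>\<^bsub>G\<^esub> z}. f z)"
    by (simp add: adj_def sum.inter_filter of_bool_def if_distrib cong: if_cong)
       (auto intro!: sum.cong)
  also have "{z\<in>verts G. x \<rightarrow>\<^bsub>G\<^esub> z} = {z. x \<rightarrow>\<^bsub>G\<^esub> z}" by auto
  finally show ?thesis .
qed

lemma finite_nbrs: "finite {z. x \<rightarrow>\<^bsub>G\<^esub> z}"
  by (rule finite_subset[OF _ finite_verts]) auto

lemma finite_awalks: "finite {p. awalk x p y \<and> length p = l}"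
  by (rule finite_subset[OF _ finite_lists_length_eq[OF finite_arcs, of l]]) (auto simp: awalk_def)

text \<open>Injectivity is the absence of parallel arcs; sums over arcs thus become sums over
  neighbours.\<close>

lemma bij_betw_head_out_arcs: "bij_betw (head G) (out_arcs G x) {z. x \<rightarrow>\<^bsub>G\<^esub> z}"
proof (rule bij_betwI')
  fix a b assume "a \<in> out_arcs G x" "b \<in> out_arcs G x"
  then show "(head G a = head G b) = (a = b)"
    using no_multi_arcs by (auto simp: arc_to_ends_def)
qed (auto simp: arcs_ends_conv)

lemma out_degree_eq_card_nbrs: "out_degree G x = card {z. x \<rightarrow>\<^bsub>G\<^esub> z}"
  unfolding out_degree_def by (rule bij_betw_same_card[OF bij_betw_head_out_arcs])

lemma walks_0: "x \<in> verts G \<Longrightarrow> walks 0 x y = of_bool (x = y)"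
proof -
  assume "x \<in> verts G"
  then have "{p. awalk x p y \<and> length p = 0} = (if x = y then {[]} else {})"
    by (auto simp: awalk_Nil_iff)
  then show ?thesis by (simp add: walks_def num_walks_def)
qed

text \<open>Splitting off the first arc is one multiplication by \<open>A\<close>, so on vertices
  \<open>walks l\<close> holds the entries of \<open>A^l\<close>.\<close>

lemma walks_Suc: "walks (Suc l) x y = (\<Sum>z\<in>verts G. adj x z * walks l z y)"
proof -
  have "{p. awalk x p y \<and> length p = Suc l} =
      (\<Union>a\<in>out_arcs G x. (#) a ` {p. awalk (head G a) p y \<and> length p = l})"
    by (auto simp: length_Suc_conv awalk_Cons_iff)
  then have "num_walks G (Suc l) x y =
      card (\<Union>a\<in>out_arcs G x. (#) a ` {p. awalk (head G a) p y \<and> length p = l})"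
    by (simp add: num_walks_def)
  also have "\<dots> = (\<Sum>a\<in>out_arcs G x. card ((#) a ` {p. awalk (head G a) p y \<and> length p = l}))"
    by (rule card_UN_disjoint) (auto simp: finite_awalks)
  also have "\<dots> = (\<Sum>a\<in>out_arcs G x. num_walks G l (head G a) y)"
    by (simp add: card_image num_walks_def)
  also have "\<dots> = (\<Sum>z | x \<rightarrow>\<^bsub>G\<^esub> z. num_walks G l z y)"
    by (rule sum.reindex_bij_betw[OF bij_betw_head_out_arcs])
  finally show ?thesis by (simp add: walks_def sum_adj)
qed

lemma walks_1: "y \<in> verts G \<Longrightarrow> walks 1 x y = adj x y"
  by (simp add: walks_Suc walks_0 if_distrib cong: if_cong)

lemma walks_2:
  assumes "y \<in> verts G"
  shows "walks 2 x y = card {z\<in>verts G. x \<rightarrow>\<^bsub>G\<^esub> z \<and> y \<rightarrow>\<^bsub>G\<^esub> z}"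
proof -
  have "walks 2 x y = (\<Sum>z\<in>verts G. adj x z * adj z y)"
    using assms walks_Suc[of 1 x y] walks_1 by (simp add: numeral_2_eq_2)
  also have "\<dots> = (\<Sum>z\<in>verts G. of_bool (x \<rightarrow>\<^bsub>G\<^esub> z \<and> y \<rightarrow>\<^bsub>G\<^esub> z))"
    by (rule sum.cong) (simp_all add: adj_sym[of _ y], simp add: adj_def of_bool_conj)
  also have "\<dots> = card {z\<in>verts G. x \<rightarrow>\<^bsub>G\<^esub> z \<and> y \<rightarrow>\<^bsub>G\<^esub> z}"
    by simp (rule arg_cong[where f=card], auto)
  finally show ?thesis .
qed

lemma walks_add:
  assumes "x \<in> verts G"
  shows "walks (i + j) x y = (\<Sum>z\<in>verts G. walks i x z * walks j z y)"
  using assms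
proof (induction i arbitrary: x)
  case 0
  then show ?case by (simp add: walks_0 if_distrib cong: if_cong)
next
  case (Suc i)
  have "walks (Suc i + j) x y = (\<Sum>w\<in>verts G. \<Sum>z\<in>verts G. adj x w * (walks i w z * walks j z y))"
    by (simp add: walks_Suc Suc.IH sum_distrib_left)
  also have "\<dots> = (\<Sum>z\<in>verts G. \<Sum>w\<in>verts G. adj x w * (walks i w z * walks j z y))"
    by (rule sum.swap)
  also have "\<dots> = (\<Sum>z\<in>verts G. walks (Suc i) x z * walks j z y)"
    by (simp add: walks_Suc sum_distrib_right mult.assoc)
  finally show ?case .
qed

lemma walks_sym:
  assumes "x \<in> verts G" "y \<in> verts G"
  shows "walks l x y = walks l y x"
  using assms
proof (induction l arbitrary: x)
  case 0
  then show ?case by (auto simp: walks_0)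
next
  case (Suc l)
  have "walks (Suc l) x y = (\<Sum>z\<in>verts G. walks l y z * walks 1 z x)"
    using Suc by (simp add: walks_Suc[of l x] walks_1 adj_sym[of x] Suc.IH mult.commute
        del: One_nat_def cong: sum.cong)
  also have "\<dots> = walks (Suc l) y x"
    using walks_add[of y l 1 x] Suc.prems by simp
  finally show ?case .
qed

section \<open>Polynomials in the adjacency matrix\<close>

lemma adj_poly_altdef:
  assumes "degree p \<le> n"
  shows "adj_poly p x y = (\<Sum>i\<le>n. coeff p i * walks i x y)"
  unfolding adj_poly_def using assms
  by (intro sum.mono_neutral_left) (auto simp: coeff_eq_0)

lemma adj_poly_0 [simp]: "adj_poly 0 x y = 0"
  by (simp add: adj_poly_def)

lemma adj_poly_add: "adj_poly (p + q) x y = adj_poly p x y + adj_poly q x y"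
proof -
  define n where "n = max (degree p) (degree q)"
  have "degree (p + q) \<le> n" "degree p \<le> n" "degree q \<le> n"
    by (auto simp: n_def degree_add_le_max)
  then show ?thesis by (simp add: adj_poly_altdef[of _ n] sum.distrib algebra_simps)
qed

lemma adj_poly_smult: "adj_poly (smult c p) x y = c * adj_poly p x y"
  by (subst adj_poly_altdef[of _ "degree p"])
     (auto simp: adj_poly_def sum_distrib_left mult.assoc)

text \<open>Horner step \<open>c I + A p(A)\<close>, which drives the induction for
  products.\<close>

lemma adj_poly_pCons: "x \<in> verts G \<Longrightarrow>
    adj_poly (pCons c p) x y = c * of_bool (x = y) + (\<Sum>z\<in>verts G. adj x z * adj_poly p z y)"
proof -
  assume x: "x \<in> verts G"
  have "adj_poly (pCons c p) x y = (\<Sum>i\<le>Suc (degree p). coeff (pCons c p) i * walks i x y)"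
    by (rule adj_poly_altdef) (rule degree_pCons_le)
  also have "\<dots> = c * of_bool (x = y) +
      (\<Sum>i\<le>degree p. \<Sum>z\<in>verts G. coeff p i * (adj x z * walks i z y))"
    using x by (subst sum.atMost_Suc_shift) (simp add: walks_0 walks_Suc sum_distrib_left)
  also have "(\<Sum>i\<le>degree p. \<Sum>z\<in>verts G. coeff p i * (adj x z * walks i z y)) =
      (\<Sum>z\<in>verts G. adj x z * adj_poly p z y)"
    by (subst sum.swap) (simp add: adj_poly_def sum_distrib_left algebra_simps)
  finally show ?thesis .
qed

lemma adj_poly_mult:
  assumes "x \<in> verts G"
  shows "adj_poly (p * q) x y = (\<Sum>z\<in>verts G. adj_poly p x z * adj_poly q z y)"
  using assms
proof (induction p arbitrary: x)
  case 0
  then show ?case by simp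
next
  case (pCons c p)
  have "(\<Sum>w\<in>verts G. adj_poly (pCons c p) x w * adj_poly q w y) =
      (\<Sum>w\<in>verts G. (if x = w then c * adj_poly q w y else 0)) +
      (\<Sum>w\<in>verts G. \<Sum>z\<in>verts G. adj x z * (adj_poly p z w * adj_poly q w y))"
    unfolding sum.distrib[symmetric] using pCons.prems
    by (intro sum.cong) (auto simp: adj_poly_pCons sum_distrib_left sum_distrib_right algebra_simps)
  also have "\<dots> = c * adj_poly q x y +
      (\<Sum>z\<in>verts G. \<Sum>w\<in>verts G. adj x z * (adj_poly p z w * adj_poly q w y))"
    using pCons.prems by (subst sum.swap) simp
  also have "\<dots> = c * adj_poly q x y + (\<Sum>z\<in>verts G. adj x z * adj_poly (p * q) z y)"
    by (simp add: pCons.IH sum_distrib_left)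
  also have "\<dots> = adj_poly (pCons c p * q) x y"
    using pCons.prems by (simp add: adj_poly_add adj_poly_smult adj_poly_pCons)
  finally show ?case by simp
qed

lemma adj_poly_sym:
  assumes "x \<in> verts G" "y \<in> verts G"
  shows "adj_poly p x y = adj_poly p y x"
  using assms by (simp add: adj_poly_def walks_sym[of x y])

lemma adj_poly_mult_linear:
  assumes "x \<in> verts G" "y \<in> verts G"
  shows "adj_poly (p * [:a, b:]) x y =
    a * adj_poly p x y + b * (\<Sum>z\<in>verts G. adj_poly p x z * adj z y)"
proof -
  have const: "adj_poly [:b:] w y = (if w = y then b else 0)" if "w \<in> verts G" for w
    using that by (simp add: adj_poly_pCons)
  have "adj_poly [:a, b:] z y = a * of_bool (z = y) + b * adj z y" if "z \<in> verts G" for z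
    unfolding adj_poly_pCons[OF that, of a]
    using assms(2) by (simp add: const if_distrib cong: if_cong sum.cong)
  then have "adj_poly (p * [:a, b:]) x y =
      (\<Sum>z\<in>verts G. (if z = y then a * adj_poly p x z else 0) + b * (adj_poly p x z * adj z y))"
    unfolding adj_poly_mult[OF assms(1)] by (intro sum.cong) (auto simp: algebra_simps)
  then show ?thesis using assms by (simp add: sum.distrib sum_distrib_left)
qed

section \<open>Distances 0 and 1, and walk-regularity on the diagonal and on edges\<close>

lemma graph_dist_self:
  assumes "x \<in> verts G"
  shows "graph_dist G x x = 0"
proof (rule antisym)
  show "graph_dist G x x \<le> 0"
    unfolding graph_dist_def using min_cost_le_walk_cost[of x "[]" x "\<lambda>_. 1"] assms
    by (simp add: awalk_Nil_iff zero_ereal_def)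
  show "0 \<le> graph_dist G x x"
    unfolding graph_dist_def \<mu>_def
    by (intro INF_greatest) (auto intro: pos_cost_pos_awalk_cost)
qed

lemma graph_dist_adjacent:
  assumes "x \<rightarrow>\<^bsub>G\<^esub> y"
  shows "graph_dist G x y = 1"
proof (rule antisym)
  obtain a where a: "a \<in> arcs G" "tail G a = x" "head G a = y"
    using assms by (auto simp: arcs_ends_conv)
  then have "awalk x [a] y" by (auto simp: awalk_simps)
  then show "graph_dist G x y \<le> 1"
    unfolding graph_dist_def using min_cost_le_walk_cost[of x "[a]" y "\<lambda>_. 1"]
    by (simp add: one_ereal_def)
  show "1 \<le> graph_dist G x y"
    unfolding graph_dist_def \<mu>_def
  proof (intro INF_greatest)
    fix p assume "p \<in> {p. awalk x p y}"
    moreover have "x \<noteq> y" using assms adj_not_same by auto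
    ultimately have "length p \<ge> 1" by (cases p) (auto simp: awalk_Nil_iff)
    moreover have "awalk_cost (\<lambda>_. 1) p = real (length p)"
      by (induction p) auto
    ultimately show "1 \<le> ereal (awalk_cost (\<lambda>_. 1) p)"
      by (simp add: one_ereal_def)
  qed
qed

lemma walk_regular_diag:
  assumes "walk_regular 1 G" "x \<in> verts G" "u \<in> verts G"
  shows "walks l x x = walks l u u"
proof -
  have "num_walks G l x x = num_walks G l u u"
    using assms(1)[unfolded walk_regular_def, rule_format, of u u x x l] assms(2,3)
    by (simp add: graph_dist_self)
  then show ?thesis by (simp add: walks_def)
qed

lemma walk_regular_edge:
  assumes "walk_regular 1 G" "x \<rightarrow>\<^bsub>G\<^esub> y" "u \<rightarrow>\<^bsub>G\<^esub> v"
  shows "walks l x y = walks l u v"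
proof -
  have "graph_dist G x y = 1" "graph_dist G u v = 1"
    using assms graph_dist_adjacent by auto
  moreover have "x \<in> verts G" "y \<in> verts G" "u \<in> verts G" "v \<in> verts G"
    using assms by auto
  ultimately have "num_walks G l x y = num_walks G l u v"
    using assms(1)[unfolded walk_regular_def, rule_format, of u v x y l] by (simp add: one_ereal_def)
  then show ?thesis by (simp add: walks_def)
qed

lemma walk_regular_adj_poly_diag:
  assumes "walk_regular 1 G" "x \<in> verts G" "u \<in> verts G"
  shows "adj_poly p x x = adj_poly p u u"
  unfolding adj_poly_def using walk_regular_diag[OF assms] by simp

lemma walk_regular_adj_poly_edge:
  assumes "walk_regular 1 G" "x \<rightarrow>\<^bsub>G\<^esub> y" "u \<rightarrow>\<^bsub>G\<^esub> v"
  shows "adj_poly p x y = adj_poly p u v"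
  unfolding adj_poly_def using walk_regular_edge[OF assms] by simp

lemma card_nbrs_eq_walks: "x \<in> verts G \<Longrightarrow> real (card {z. x \<rightarrow>\<^bsub>G\<^esub> z}) = walks 2 x x"
  by (subst walks_2) (auto intro!: arg_cong[where f=card])

lemma walk_regular_imp_regular:
  assumes "walk_regular 1 G" "x \<in> verts G" "u \<in> verts G"
  shows "card {z. x \<rightarrow>\<^bsub>G\<^esub> z} = card {z. u \<rightarrow>\<^bsub>G\<^esub> z}"
  using card_nbrs_eq_walks[OF assms(2)] card_nbrs_eq_walks[OF assms(3)]
    walk_regular_diag[OF assms, of 2] by simp

text \<open>If \<open>A v = k v\<close> for a \<open>k\<close>-regular graph, then the sum of \<open>(v x - v y)\<^sup>2\<close> over all
  arcs vanishes.\<close>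

lemma degree_eigenvector_const_on_edges:
  assumes reg: "\<And>x. x \<in> verts G \<Longrightarrow> (\<Sum>y\<in>verts G. adj x y) = k"
    and ev: "\<And>y. y \<in> verts G \<Longrightarrow> (\<Sum>x\<in>verts G. v x * adj x y) = k * v y"
    and xy: "x \<rightarrow>\<^bsub>G\<^esub> y"
  shows "v x = v y"
proof -
  let ?V = "verts G"
  have "(\<Sum>x\<in>?V. \<Sum>y\<in>?V. adj x y * (v x - v y)\<^sup>2) =
      (\<Sum>x\<in>?V. \<Sum>y\<in>?V. (v x)\<^sup>2 * adj x y) + (\<Sum>x\<in>?V. \<Sum>y\<in>?V. adj x y * (v y)\<^sup>2)
      - 2 * (\<Sum>x\<in>?V. \<Sum>y\<in>?V. v y * (v x * adj x y))"
    by (simp add: power2_diff algebra_simps sum.distrib sum_subtractf sum_distrib_left)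
  \<comment> \<open>Each of the three sums is \<open>k\<close> times the squared norm of
    \<open>v\<close>: the cross term by \<open>ev\<close>, the others by regularity and
    symmetry.\<close>
  also have "(\<Sum>x\<in>?V. \<Sum>y\<in>?V. v y * (v x * adj x y)) = (\<Sum>y\<in>?V. v y * (\<Sum>x\<in>?V. v x * adj x y))"
    by (subst sum.swap) (simp add: sum_distrib_left)
  also have "\<dots> = k * (\<Sum>y\<in>?V. (v y)\<^sup>2)"
    by (simp add: ev sum_distrib_left power2_eq_square algebra_simps)
  also have "(\<Sum>x\<in>?V. \<Sum>y\<in>?V. (v x)\<^sup>2 * adj x y) = k * (\<Sum>y\<in>?V. (v y)\<^sup>2)"
    unfolding sum_distrib_left[of k] by (rule sum.cong) (simp_all add: reg flip: sum_distrib_left)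
  also have "(\<Sum>x\<in>?V. \<Sum>y\<in>?V. adj x y * (v y)\<^sup>2) = (\<Sum>y\<in>?V. (v y)\<^sup>2 * (\<Sum>x\<in>?V. adj y x))"
    unfolding sum_distrib_left by (subst sum.swap) (intro sum.cong refl, subst adj_sym, rule mult.commute)
  also have "\<dots> = k * (\<Sum>y\<in>?V. (v y)\<^sup>2)"
    unfolding sum_distrib_left[of k] by (rule sum.cong) (simp_all add: reg)
  finally have "(\<Sum>x\<in>?V. \<Sum>y\<in>?V. adj x y * (v x - v y)\<^sup>2) = 0" by simp
  then have "\<forall>x\<in>?V. \<forall>y\<in>?V. adj x y * (v x - v y)\<^sup>2 = 0"
    by (simp add: sum_nonneg_eq_0_iff sum_nonneg adj_def)
  moreover have "x \<in> ?V" "y \<in> ?V" using xy by auto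
  ultimately have "adj x y * (v x - v y)\<^sup>2 = 0" by blast
  then show ?thesis using xy by (simp add: adj_def)
qed

end

section \<open>Regular cliques in 1-walk-regular graphs\<close>

locale walk_regular_clique_graph = graph +
  fixes C :: "'a set" and e :: nat and k :: nat
  assumes wr: "walk_regular 1 G"
    and clique: "clique G C"
    and e_pos: "e > 0"
    and outside: "x \<in> verts G - C \<Longrightarrow> card {y\<in>C. x \<rightarrow>\<^bsub>G\<^esub> y} = e"
    and degree: "x \<in> verts G \<Longrightarrow> card {z. x \<rightarrow>\<^bsub>G\<^esub> z} = k"
begin

lemma C_subset: "C \<subseteq> verts G"
  using clique by (simp add: clique_def)

lemma finite_C: "finite C"
  using C_subset finite_verts by (rule finite_subset)

lemma C_adj: "x \<in> C \<Longrightarrow> y \<in> C \<Longrightarrow> x \<noteq> y \<Longrightarrow> x \<rightarrow>\<^bsub>G\<^esub> y"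
  using clique by (auto simp: clique_def)

abbreviation "c \<equiv> card C"

lemma sum_adj_nbrs: "x \<in> verts G \<Longrightarrow> (\<Sum>z\<in>verts G. adj x z) = k"
  using sum_adj[of x "\<lambda>_. 1"] degree by simp

text \<open>If \<open>C\<close> and its complement are nonempty, this is the eigenvalue besides
  \<open>k\<close> of the quotient matrix of that partition.\<close>

definition \<tau> :: real where
  "\<tau> = real c - 1 - real e"

lemma sum_adj_clique:
  assumes "x \<in> verts G"
  shows "(\<Sum>y\<in>C. adj x y) = \<tau> * of_bool (x \<in> C) + e"
proof -
  have "(\<Sum>y\<in>C. adj x y) = card {y\<in>C. x \<rightarrow>\<^bsub>G\<^esub> y}"
    using finite_C by (simp add: adj_def Int_def conj_commute flip: sum.inter_filter)
  also have "\<dots> = \<tau> * of_bool (x \<in> C) + e"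
  proof (cases "x \<in> C")
    case True
    have "{y\<in>C. x \<rightarrow>\<^bsub>G\<^esub> y} = C - {x}"
      using C_adj True adj_not_same by auto
    \<comment> \<open>Keeps the truncated \<open>c - 1\<close> equal to its real value.\<close>
    moreover have "c \<ge> 1" using True finite_C by (metis One_nat_def Suc_leI card_gt_0_iff empty_iff)
    ultimately show ?thesis using True finite_C by (simp add: \<tau>_def)
  next
    case False
    then show ?thesis using outside assms by simp
  qed
  finally show ?thesis .
qed

text \<open>\<open>A - \<tau>\<close> sends the characteristic vector of \<open>C\<close> to
  \<open>e\<close> times the all-ones vector, which \<open>A - k\<close> kills by
  regularity.\<close>

lemma adj_poly_annihilates_clique:
  assumes x: "x \<in> verts G"
  shows "(\<Sum>y\<in>C. adj_poly (p * [:-real k, 1:] * [:-\<tau>, 1:]) x y) = 0"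
proof -
  let ?V = "verts G"
  define q where "q = p * [:-real k, 1:]"
  have "(\<Sum>y\<in>C. adj_poly (q * [:-\<tau>, 1:]) x y) =
      - \<tau> * (\<Sum>y\<in>C. adj_poly q x y) + (\<Sum>y\<in>C. \<Sum>z\<in>?V. adj_poly q x z * adj z y)"
    unfolding sum_distrib_left sum.distrib[symmetric]
    using C_subset adj_poly_mult_linear[OF x] by (intro sum.cong) (auto simp del: mult_pCons_right)
  also have "(\<Sum>y\<in>C. \<Sum>z\<in>?V. adj_poly q x z * adj z y) =
      (\<Sum>z\<in>?V. adj_poly q x z * (\<tau> * of_bool (z \<in> C) + e))"
    by (subst sum.swap) (simp add: sum_adj_clique flip: sum_distrib_left)
  also have "\<dots> = \<tau> * (\<Sum>z\<in>?V. if z \<in> C then adj_poly q x z else 0) + e * (\<Sum>z\<in>?V. adj_poly q x z)"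
    unfolding sum_distrib_left sum.distrib[symmetric]
    by (rule sum.cong) (auto simp: algebra_simps)
  also have "(\<Sum>z\<in>?V. if z \<in> C then adj_poly q x z else 0) = (\<Sum>z\<in>C. adj_poly q x z)"
    using C_subset by (simp add: sum.inter_restrict[symmetric] Int_absorb1)
  \<comment> \<open>The two \<open>\<tau>\<close> sums cancel; what is left is \<open>e\<close>
    times a row sum of \<open>q(A)\<close>.\<close>
  also have "(\<Sum>y\<in>?V. adj_poly q x y) = 0"
  proof -
    have "(\<Sum>y\<in>?V. adj_poly q x y) =
        - k * (\<Sum>y\<in>?V. adj_poly p x y) + (\<Sum>y\<in>?V. \<Sum>z\<in>?V. adj_poly p x z * adj z y)"
      unfolding sum_distrib_left sum.distrib[symmetric] q_def
      using adj_poly_mult_linear[OF x] by (intro sum.cong) (auto simp del: mult_pCons_right)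
    also have "(\<Sum>y\<in>?V. \<Sum>z\<in>?V. adj_poly p x z * adj z y) = (\<Sum>z\<in>?V. adj_poly p x z * k)"
      by (subst sum.swap) (simp add: sum_adj_nbrs flip: sum_distrib_left)
    finally show ?thesis by (simp add: mult.commute flip: sum_distrib_left)
  qed
  finally show ?thesis by (simp add: q_def)
qed

text \<open>The sum runs over the \<open>k\<close> edges at \<open>x\<close>, on each of which
  \<open>p(A)\<close> takes its common edge value.\<close>

lemma adj_poly_mult_X_diag:
  assumes x: "x \<in> verts G" and uv: "u \<rightarrow>\<^bsub>G\<^esub> v"
  shows "(\<Sum>z\<in>verts G. adj_poly p x z * adj z x) = k * adj_poly p u v"
proof -
  have "(\<Sum>z\<in>verts G. adj_poly p x z * adj z x) = (\<Sum>z | x \<rightarrow>\<^bsub>G\<^esub> z. adj_poly p x z)"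
    unfolding sum_adj[symmetric] by (intro sum.cong) (auto simp: adj_sym[of x])
  also have "\<dots> = (\<Sum>z | x \<rightarrow>\<^bsub>G\<^esub> z. adj_poly p u v)"
    by (rule sum.cong) (auto intro: walk_regular_adj_poly_edge[OF wr _ uv])
  finally show ?thesis by (simp add: degree[OF x])
qed

text \<open>For \<open>p = r (X - k) (X - \<tau>)\<close> the sum of the entries of \<open>p(A)\<close> over \<open>C \<times> C\<close> vanishes. By
  walk-regularity that sum is \<open>c a + c (c - 1) b\<close>, with \<open>a\<close> and \<open>b\<close> the values of \<open>p(A)\<close> on the
  diagonal and on the edges, while \<open>k b\<close> is the diagonal value of \<open>A p(A)\<close>.\<close>

lemma adj_poly_diag_eq_0:
  assumes c: "c \<ge> 2" and x: "x \<in> verts G"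
  shows "adj_poly (r * [:-real k, 1:] * [:-\<tau>, 1:] * [:real k, real c - 1:]) x x = 0"
proof -
  define p where "p = r * [:-real k, 1:] * [:-\<tau>, 1:]"
  from c obtain u v where uv: "u \<in> C" "v \<in> C" "u \<noteq> v"
    by (metis card_le_Suc0_iff_eq finite_C not_less_eq_eq numeral_2_eq_2)
  then have "u \<rightarrow>\<^bsub>G\<^esub> v" by (rule C_adj)
  define a where "a = adj_poly p x x"
  define b where "b = adj_poly p u v"
  have row: "(\<Sum>z\<in>C. adj_poly p y z) = a + (real c - 1) * b" if y: "y \<in> C" for y
  proof -
    have "(\<Sum>z\<in>C. adj_poly p y z) = adj_poly p y y + (\<Sum>z\<in>C - {y}. adj_poly p y z)"
      using finite_C y by (rule sum.remove)
    also have "adj_poly p y y = a"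
      unfolding a_def using walk_regular_adj_poly_diag[OF wr _ x] y C_subset by blast
    also have "(\<Sum>z\<in>C - {y}. adj_poly p y z) = (\<Sum>z\<in>C - {y}. b)"
      unfolding b_def using walk_regular_adj_poly_edge[OF wr _ \<open>u \<rightarrow>\<^bsub>G\<^esub> v\<close>] C_adj y
      by (intro sum.cong) auto
    also have "\<dots> = (real c - 1) * b" using y finite_C c by (simp add: of_nat_diff)
    finally show ?thesis .
  qed
  \<comment> \<open>The last factor is chosen to weight \<open>a\<close> and \<open>b\<close> as a
    row sum over \<open>C\<close> does, up to the factor \<open>k\<close>.\<close>
  have "adj_poly (p * [:real k, real c - 1:]) x x = k * a + (real c - 1) * (k * b)"
    unfolding adj_poly_mult_linear[OF x x] adj_poly_mult_X_diag[OF x \<open>u \<rightarrow>\<^bsub>G\<^esub> v\<close>] a_def b_def ..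
  also have "\<dots> = k * (a + (real c - 1) * b)"
    by (simp only: algebra_simps)
  also have "a + (real c - 1) * b = (\<Sum>z\<in>C. adj_poly p u z)"
    using row[OF uv(1)] by (rule sym)
  also have "\<dots> = 0"
    unfolding p_def using C_subset uv(1) by (intro adj_poly_annihilates_clique) auto
  finally show ?thesis
    unfolding p_def mult_zero_right .
qed

text \<open>With \<open>r = Q\<close>, the vanishing diagonal of \<open>Q(A)^2\<close> consists, by
  symmetry, of the sums of squares of the rows of \<open>Q(A)\<close>.\<close>

lemma adj_poly_cubic_eq_0:
  assumes c: "c \<ge> 2" and x: "x \<in> verts G" and y: "y \<in> verts G"
  shows "adj_poly ([:-real k, 1:] * [:-\<tau>, 1:] * [:real k, real c - 1:]) x y = 0"
proof -
  define Q where "Q = [:-real k, 1:] * [:-\<tau>, 1:] * [:real k, real c - 1:]"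
  have "adj_poly (Q * Q) x x = 0"
    using adj_poly_diag_eq_0[OF c x, of Q] by (simp only: Q_def mult.assoc)
  moreover have "adj_poly (Q * Q) x x = (\<Sum>z\<in>verts G. (adj_poly Q x z)\<^sup>2)"
    unfolding adj_poly_mult[OF x] power2_eq_square
    by (rule sum.cong) (simp_all add: adj_poly_sym[OF x])
  ultimately have "(\<Sum>z\<in>verts G. (adj_poly Q x z)\<^sup>2) = 0" by simp
  then have "adj_poly Q x y = 0" using y by (simp add: sum_nonneg_eq_0_iff)
  then show ?thesis unfolding Q_def .
qed

text \<open>Connectedness through \<open>C\<close>: as \<open>e > 0\<close>, each outside vertex has
  a neighbour in \<open>C\<close>, and members of \<open>C\<close> are mutually adjacent.\<close>

lemma eq_if_const_on_edges:
  assumes edge: "\<And>x y. x \<rightarrow>\<^bsub>G\<^esub> y \<Longrightarrow> v x = v y" and "x \<in> verts G" "y \<in> verts G"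
  shows "v x = v y"
proof -
  have nbr: "\<exists>w\<in>C. v x = v w" if "x \<in> verts G" for x
  proof (cases "x \<in> C")
    case False
    then have "{y\<in>C. x \<rightarrow>\<^bsub>G\<^esub> y} \<noteq> {}"
      using outside[of x] e_pos that by (metis DiffI card.empty less_irrefl)
    then show ?thesis using edge by auto
  qed auto
  show ?thesis using nbr[OF assms(2)] nbr[OF assms(3)] C_adj edge by metis
qed

text \<open>The cubic identity makes each row an eigenvector for \<open>k\<close>, hence constant;
  the equal diagonal entries tie the rows together.\<close>

lemma adj_poly_quadratic_const:
  assumes c: "c \<ge> 2" and x: "x \<in> verts G" "y \<in> verts G" and u: "u \<in> verts G" "w \<in> verts G"
  shows "adj_poly ([:-\<tau>, 1:] * [:real k, real c - 1:]) x y =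
    adj_poly ([:-\<tau>, 1:] * [:real k, real c - 1:]) u w"
proof -
  define M where "M = [:-\<tau>, 1:] * [:real k, real c - 1:]"
  have row: "adj_poly M x y = adj_poly M x x" if x: "x \<in> verts G" and y: "y \<in> verts G" for x y
  proof (rule eq_if_const_on_edges[OF degree_eigenvector_const_on_edges y x])
    fix y assume y: "y \<in> verts G"
    have "adj_poly (M * [:-real k, 1:]) x y = 0"
      using adj_poly_cubic_eq_0[OF c x y] by (simp only: M_def mult_ac)
    then show "(\<Sum>z\<in>verts G. adj_poly M x z * adj z y) = k * adj_poly M x y"
      unfolding adj_poly_mult_linear[OF x y] by simp
  qed (auto simp: sum_adj_nbrs)
  show ?thesis
    unfolding M_def[symmetric] row[OF x] row[OF u] by (rule walk_regular_adj_poly_diag[OF wr x(1) u(1)])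
qed

text \<open>At these pairs \<open>I\<close> and \<open>A\<close> vanish, so the constant quadratic
  fixes \<open>(c - 1) A^2\<close>. One divides by \<open>c - 1\<close> when
  \<open>c \<ge> 2\<close>; smaller cliques leave no such pair.\<close>

lemma card_common_nbrs_nonadjacent:
  assumes x: "x \<in> verts G" "y \<in> verts G" "x \<noteq> y" "\<not> x \<rightarrow>\<^bsub>G\<^esub> y"
    and u: "u \<in> verts G" "w \<in> verts G" "u \<noteq> w" "\<not> u \<rightarrow>\<^bsub>G\<^esub> w"
  shows "card {z\<in>verts G. x \<rightarrow>\<^bsub>G\<^esub> z \<and> y \<rightarrow>\<^bsub>G\<^esub> z} = card {z\<in>verts G. u \<rightarrow>\<^bsub>G\<^esub> z \<and> w \<rightarrow>\<^bsub>G\<^esub> z}"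
proof -
  have "c \<noteq> 0"
  proof
    assume "c = 0"
    then have "C = {}" using finite_C by simp
    then show False using outside[of x] x e_pos by simp
  qed
  moreover have "c \<noteq> 1"
  proof
    assume "c = 1"
    then obtain s where s: "C = {s}" by (rule card_1_singletonE)
    \<comment> \<open>With \<open>n\<close> vertices, \<open>s\<close> then has degree at least
      \<open>n - 1\<close>, while \<open>x\<close> misses itself and \<open>y\<close> and has degree
      at most \<open>n - 2\<close>.\<close>
    have "t \<rightarrow>\<^bsub>G\<^esub> s" if "t \<in> verts G" "t \<noteq> s" for t
      using outside[of t] that s e_pos by (auto split: if_splits) (metis (mono_tags) card_gt_0_iff empty_Collect_eq)
    then have "verts G - {s} \<subseteq> {z. s \<rightarrow>\<^bsub>G\<^esub> z}"
      using sym_arcs by (auto simp: symmetric_def dest: symD)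
    then have "card (verts G) - 1 \<le> k"
      using degree[of s] s C_subset card_mono[OF finite_nbrs, of "verts G - {s}" s] by simp
    moreover have "{z. x \<rightarrow>\<^bsub>G\<^esub> z} \<subseteq> verts G - {x} - {y}"
      using x adj_not_same by auto
    then have "k \<le> card (verts G - {x} - {y})"
      using degree[OF x(1)] by (metis card_mono finite_Diff finite_verts)
    moreover have "card (verts G - {x} - {y}) < card (verts G - {x})"
      using x by (intro psubset_card_mono) auto
    ultimately show False using x by simp
  qed
  ultimately have c: "c \<ge> 2" by simp
  have *: "adj_poly ([:-\<tau>, 1:] * [:real k, real c - 1:]) x y = (real c - 1) * walks 2 x y"
    if "x \<in> verts G" "y \<in> verts G" "x \<noteq> y" "\<not> x \<rightarrow>\<^bsub>G\<^esub> y" for x y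
  proof -
    have "adj x y = 0" using that by (simp add: adj_def)
    moreover have "walks 2 x y = (\<Sum>z\<in>verts G. adj x z * adj z y)"
      using that walks_Suc[of 1 x y] walks_1 by (simp add: numeral_2_eq_2)
    \<comment> \<open>The entry \<open>-\<tau>\<close> occurs only at \<open>z = x\<close>, where it
      meets \<open>adj x y = 0\<close>.\<close>
    moreover have "(\<Sum>z\<in>verts G. adj_poly [:-\<tau>, 1:] x z * adj z y) = (\<Sum>z\<in>verts G. adj x z * adj z y)"
      using \<open>x \<in> verts G\<close> \<open>adj x y = 0\<close>
      by (intro sum.cong) (auto simp: adj_poly_pCons if_distrib cong: if_cong)
    moreover have "adj_poly [:-\<tau>, 1:] x y = 0"
      using that \<open>adj x y = 0\<close> by (simp add: adj_poly_pCons if_distrib cong: if_cong)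
    ultimately show ?thesis
      unfolding adj_poly_mult_linear[OF that(1,2)] by simp
  qed
  have "(real c - 1) * walks 2 x y = (real c - 1) * walks 2 u w"
    using adj_poly_quadratic_const[OF c x(1,2) u(1,2)] *[OF x] *[OF u] by simp
  then have "walks 2 x y = walks 2 u w" using c by simp
  then show ?thesis by (simp add: walks_2 x u)
qed

end

section \<open>Parameters of the strongly regular graph\<close>

theorem theorem2p32:
  fixes G :: "('a, 'b) pre_digraph" and C :: "'a set"
  assumes "graph G"
    and "walk_regular 1 G"
    and "regular_clique G C"
  shows "\<exists>n k lam mu. strongly_regular G n k lam mu"
proof -
  interpret graph G by fact
  obtain e where e: "clique G C" "e > 0" "\<forall>x\<in>verts G - C. card {y\<in>C. x \<rightarrow>\<^bsub>G\<^esub> y} = e"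
    using assms(3) by (auto simp: regular_clique_def)
  obtain k where k: "\<forall>x\<in>verts G. card {z. x \<rightarrow>\<^bsub>G\<^esub> z} = k"
    using walk_regular_imp_regular[OF assms(2)] by metis
  interpret walk_regular_clique_graph G C e k
    using assms e k by unfold_locales auto
  let ?N = "\<lambda>x y. card {z \<in> verts G. x \<rightarrow>\<^bsub>G\<^esub> z \<and> y \<rightarrow>\<^bsub>G\<^esub> z}"
  \<comment> \<open>Walks of length 2 count common neighbours, so walk-regularity alone settles
    adjacent pairs.\<close>
  have "?N x y = ?N u w" if "x \<rightarrow>\<^bsub>G\<^esub> y" "u \<rightarrow>\<^bsub>G\<^esub> w" for x y u w
  proof -
    have "y \<in> verts G" "w \<in> verts G" using that by auto
    then show ?thesis using walk_regular_edge[OF assms(2) that, of 2] by (simp add: walks_2)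
  qed
  then obtain lam where lam: "\<forall>x y. x \<rightarrow>\<^bsub>G\<^esub> y \<longrightarrow> ?N x y = lam"
    using ex_common_value[of "\<lambda>x y. x \<rightarrow>\<^bsub>G\<^esub> y" ?N] by blast
  let ?P = "\<lambda>x y. x \<in> verts G \<and> y \<in> verts G \<and> x \<noteq> y \<and> \<not> x \<rightarrow>\<^bsub>G\<^esub> y"
  have "?N x y = ?N u w" if "?P x y" "?P u w" for x y u w
    using that by (intro card_common_nbrs_nonadjacent) auto
  then obtain mu where mu: "\<forall>x y. ?P x y \<longrightarrow> ?N x y = mu"
    using ex_common_value[of ?P ?N] by blast
  have "strongly_regular G (card (verts G)) k lam mu"
    unfolding strongly_regular_def out_degree_eq_card_nbrs using lam mu k by simp
  then show ?thesis by blast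
qed

end
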